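(* Let $I = \mathbb{N}$ or $I=\{1,\ldots, N\}$ with $N \in \mathbb{N}$, $N\ge 1$. For every $x = (x_n)_{n\in I} \in B_{\ell_1(I)}$, we have $$dc(x) = \delta c(x)= 1+\|x\| -2\sup \{ |x_n| : n \in I \}.$$ Moreover, $$w^*dc(x) = w^*\delta c(x) = 1+\|x\| -2\sup \{ |x_n| : n \in I \}.$$
   Context: All spaces are real. For a Banach space $X$, $B_X$, $S_X$, $X^*$ denote the closed unit ball, unit sphere and topological dual. For $x^*\in S_{X^*}$, $\delta>0$ put $S(x^*,\delta)=\{y\in B_X : x^*(y)>1-\delta\}$ (a slice of $B_X$). For $x\in B_X$: The Daugavet constant $dc(x)$ is the supremum of all $\alpha\ge 0$ such that for all $\varepsilon,\delta>0$ and all $y^*\in S_{X^*}$ there exists $y\in S(y^*,\delta)$ with $\|y-x\|>\alpha-\varepsilon$. The $\Delta$-constant $\delta c(x)$ is the supremum of all $\alpha\ge 0$ such that for all $\varepsilon,\delta>0$ and all $y^*\in S_{X^*}$ with $x\in S(y^*,\delta)$ there exists $y\in S(y^*,\delta)$ with $\|y-x\|>\alpha-\varepsilon$. In a dual space $X^*$, for $y\in S_X$ and $\delta>0$, the weak$^*$ slice is $S(y,\delta)=\{z^*\in B_{X^*} : z^*(y)>1-\delta\}$. For $x^*\in B_{X^*}$: the weak$^*$ Daugavet constant $w^*dc(x^* )$ is the supremum of all $\alpha\ge0$ such that for all $\varepsilon,\delta>0$ and all $y\in S_X$ there exists $y^*\in S(y,\delta)$ with $\|y^*-x^*\|>\alpha-\varepsilon$;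 the weak$^*$ $\Delta$-constant $w^*\delta c(x^* )$ is the supremum of all $\alpha\ge0$ such that for all $\varepsilon,\delta>0$ and all $y\in S_X$ with $x^*\in S(y,\delta)$ there exists $y^*\in S(y,\delta)$ with $\|y^*-x^*\|>\alpha-\varepsilon$. Here $\ell_1(\mathbb{N})$ is regarded as the dual of $c_0$, and $\ell_1(\{1,\dots,N\})=\ell_1^N$ as the dual of $\ell_\infty^N$. *)

theory Defs
  imports "HOL-Analysis.Bounded_Linear_Function" "HOL-Analysis.Infinite_Sum"
begin

section \<open>Daugavet and Delta constants\<close>

definition slice :: "('a::banach \<Rightarrow>\<^sub>L real) \<Rightarrow> real \<Rightarrow> 'a set"
  where "slice f d = {y \<in> cball 0 1. blinfun_apply f y > 1 - d}"

definition weak_star_slice :: "'a::banach \<Rightarrow> real \<Rightarrow> ('a \<Rightarrow>\<^sub>L real) set"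
  where "weak_star_slice y d = {f \<in> cball 0 1. blinfun_apply f y > 1 - d}"

text \<open>For a nontrivial space and a point of its closed unit ball, each of the four sets below contains
  0 and is bounded above by 2, so that the real-valued \<^const>\<open>Sup\<close> is the true supremum.\<close>

definition Daugavet_const :: "'a::banach \<Rightarrow> real"
  where "Daugavet_const x = Sup {\<alpha>. \<alpha> \<ge> 0 \<and>
    (\<forall>\<epsilon>>0. \<forall>\<delta>>0. \<forall>f \<in> sphere 0 1. \<exists>y \<in> slice f \<delta>. norm (y - x) > \<alpha> - \<epsilon>)}"

definition Delta_const :: "'a::banach \<Rightarrow> real"
  where "Delta_const x = Sup {\<alpha>. \<alpha> \<ge> 0 \<and>
    (\<forall>\<epsilon>>0. \<forall>\<delta>>0. \<forall>f \<in> sphere 0 1. x \<in> slice f \<delta> \<longrightarrow>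
      (\<exists>y \<in> slice f \<delta>. norm (y - x) > \<alpha> - \<epsilon>))}"

definition weak_star_Daugavet_const :: "('a::banach \<Rightarrow>\<^sub>L real) \<Rightarrow> real"
  where "weak_star_Daugavet_const f = Sup {\<alpha>. \<alpha> \<ge> 0 \<and>
    (\<forall>\<epsilon>>0. \<forall>\<delta>>0. \<forall>y \<in> sphere 0 1. \<exists>g \<in> weak_star_slice y \<delta>. norm (g - f) > \<alpha> - \<epsilon>)}"

definition weak_star_Delta_const :: "('a::banach \<Rightarrow>\<^sub>L real) \<Rightarrow> real"
  where "weak_star_Delta_const f = Sup {\<alpha>. \<alpha> \<ge> 0 \<and>
    (\<forall>\<epsilon>>0. \<forall>\<delta>>0. \<forall>y \<in> sphere 0 1. f \<in> weak_star_slice y \<delta> \<longrightarrow>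
      (\<exists>g \<in> weak_star_slice y \<delta>. norm (g - f) > \<alpha> - \<epsilon>))}"


section \<open>The space of absolutely summable families\<close>

typedef 'i ell1 = "{f :: 'i \<Rightarrow> real. f abs_summable_on UNIV}"
  morphisms ell1_nth Abs_ell1
  by (rule exI[of _ "\<lambda>_. 0"]) simp

setup_lifting type_definition_ell1

lemma ell1_eqI: "(\<And>i. ell1_nth x i = ell1_nth y i) \<Longrightarrow> x = y"
  by (metis ell1_nth_inject ext)

lemma ell1_summable: "(\<lambda>i. \<bar>ell1_nth x i\<bar>) summable_on UNIV"
  using ell1_nth[of x] by simp

lemma abs_summable_add:
  fixes f g :: "'i \<Rightarrow> real"
  assumes "f abs_summable_on A" "g abs_summable_on A"
  shows "(\<lambda>i. f i + g i) abs_summable_on A"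
  using assms by (metis summable_on_add summable_on_iff_abs_summable_on_real)

lemma abs_summable_cmult:
  fixes f :: "'i \<Rightarrow> real"
  assumes "f abs_summable_on A"
  shows "(\<lambda>i. c * f i) abs_summable_on A"
  using assms by (metis summable_on_cmult_right summable_on_iff_abs_summable_on_real)

instantiation ell1 :: (type) real_normed_vector
begin

lift_definition zero_ell1 :: "'a ell1" is "\<lambda>_. 0" by simp

lift_definition plus_ell1 :: "'a ell1 \<Rightarrow> 'a ell1 \<Rightarrow> 'a ell1" is "\<lambda>f g i. f i + g i"
  by (rule abs_summable_add)

lift_definition uminus_ell1 :: "'a ell1 \<Rightarrow> 'a ell1" is "\<lambda>f i. - f i" by simp

lift_definition minus_ell1 :: "'a ell1 \<Rightarrow> 'a ell1 \<Rightarrow> 'a ell1" is "\<lambda>f g i. f i - g i"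
  using abs_summable_add[where g = "\<lambda>i. - g i" for g] by simp

lift_definition scaleR_ell1 :: "real \<Rightarrow> 'a ell1 \<Rightarrow> 'a ell1" is "\<lambda>c f i. c * f i"
  by (rule abs_summable_cmult)

lift_definition norm_ell1 :: "'a ell1 \<Rightarrow> real" is "\<lambda>f. \<Sum>\<^sub>\<infinity>i. \<bar>f i\<bar>" .

definition dist_ell1 :: "'a ell1 \<Rightarrow> 'a ell1 \<Rightarrow> real"
  where "dist_ell1 x y = norm (x - y)"

definition sgn_ell1 :: "'a ell1 \<Rightarrow> 'a ell1"
  where "sgn_ell1 x = scaleR (inverse (norm x)) x"

definition uniformity_ell1 :: "('a ell1 \<times> 'a ell1) filter"
  where "uniformity_ell1 = (INF e\<in>{0 <..}. principal {(x, y). dist x y < e})"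

definition open_ell1 :: "'a ell1 set \<Rightarrow> bool"
  where "open_ell1 S = (\<forall>x\<in>S. \<forall>\<^sub>F (x', y) in uniformity. x' = x \<longrightarrow> y \<in> S)"

instance
proof
  fix x y z :: "'a ell1" and a b :: real
  show "x + y + z = x + (y + z)" "x + y = y + x" "0 + x = x" "- x + x = 0" "x - y = x + - y"
    by (transfer; auto)+
  show "a *\<^sub>R (x + y) = a *\<^sub>R x + a *\<^sub>R y" "(a + b) *\<^sub>R x = a *\<^sub>R x + b *\<^sub>R x"
    "a *\<^sub>R b *\<^sub>R x = (a * b) *\<^sub>R x" "1 *\<^sub>R x = x"
    by (transfer; auto simp: algebra_simps)+
  show "dist x y = norm (x - y)" by (rule dist_ell1_def)
  show "sgn x = inverse (norm x) *\<^sub>R x" by (rule sgn_ell1_def)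
  show "uniformity = (INF e\<in>{0 <..}. principal {(x :: 'a ell1, y). dist x y < e})"
    by (rule uniformity_ell1_def)
  show "open S = (\<forall>x\<in>S. \<forall>\<^sub>F (x', y) in uniformity. x' = x \<longrightarrow> y \<in> S)" for S :: "'a ell1 set"
    by (rule open_ell1_def)
  show "norm x = 0 \<longleftrightarrow> x = 0"
  proof
    assume "norm x = 0"
    then have "\<bar>ell1_nth x i\<bar> = 0" for i
      using nonneg_infsum_le_0D[of "\<lambda>i. \<bar>ell1_nth x i\<bar>" UNIV i] ell1_summable[of x]
      by (simp add: norm_ell1.rep_eq)
    then show "x = 0" by (intro ell1_eqI) (simp add: zero_ell1.rep_eq)
  qed (simp add: norm_ell1.rep_eq zero_ell1.rep_eq)
  show "norm (x + y) \<le> norm x + norm y"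
  proof -
    have "(\<Sum>\<^sub>\<infinity>i. \<bar>ell1_nth (x + y) i\<bar>) \<le> (\<Sum>\<^sub>\<infinity>i. \<bar>ell1_nth x i\<bar> + \<bar>ell1_nth y i\<bar>)"
      by (intro infsum_mono ell1_summable summable_on_add) (simp add: plus_ell1.rep_eq)
    then show ?thesis
      by (simp add: norm_ell1.rep_eq infsum_add ell1_summable)
  qed
  show "norm (a *\<^sub>R x) = \<bar>a\<bar> * norm x"
    by (simp add: norm_ell1.rep_eq scaleR_ell1.rep_eq abs_mult infsum_cmult_right')
qed

end

lemma sum_le_norm_ell1: "finite F \<Longrightarrow> (\<Sum>i\<in>F. \<bar>ell1_nth x i\<bar>) \<le> norm x"
  unfolding norm_ell1.rep_eq by (rule finite_sum_le_infsum) (auto simp: ell1_summable)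

lemma abs_nth_le_norm_ell1: "\<bar>ell1_nth x i\<bar> \<le> norm x"
  using sum_le_norm_ell1[of "{i}" x] by simp

lemma ell1_of_bounded_sums:
  fixes f :: "'i \<Rightarrow> real"
  assumes "\<And>F. finite F \<Longrightarrow> (\<Sum>i\<in>F. \<bar>f i\<bar>) \<le> c"
  obtains x where "ell1_nth x = f" "norm x \<le> c"
proof -
  have "f abs_summable_on UNIV"
    by (rule nonneg_bdd_above_summable_on) (use assms in \<open>auto simp: bdd_above_def\<close>)
  then have *: "ell1_nth (Abs_ell1 f) = f" by (simp add: Abs_ell1_inverse)
  moreover have "norm (Abs_ell1 f) \<le> c"
    using ell1_summable[of "Abs_ell1 f"] assms
    by (auto simp: norm_ell1.rep_eq * intro!: infsum_le_finite_sums)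
  ultimately show ?thesis by (rule that)
qed

instance ell1 :: (type) banach
proof
  fix X :: "nat \<Rightarrow> 'a ell1"
  assume X: "Cauchy X"
  have "Cauchy (\<lambda>n. ell1_nth (X n) i)" for i
    unfolding Cauchy_def
  proof (intro allI impI)
    fix e :: real assume "e > 0"
    then obtain M where M: "\<And>m n. m \<ge> M \<Longrightarrow> n \<ge> M \<Longrightarrow> dist (X m) (X n) < e"
      using X unfolding Cauchy_def by blast
    have "dist (ell1_nth (X m) i) (ell1_nth (X n) i) < e" if "m \<ge> M" "n \<ge> M" for m n
      using M[OF that] abs_nth_le_norm_ell1[of "X m - X n" i]
      by (simp add: dist_norm minus_ell1.rep_eq)
    then show "\<exists>M. \<forall>m\<ge>M. \<forall>n\<ge>M. dist (ell1_nth (X m) i) (ell1_nth (X n) i) < e" by blast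
  qed
  then have "\<exists>l. (\<lambda>n. ell1_nth (X n) i) \<longlonglongrightarrow> l" for i
    by (simp add: Cauchy_convergent_iff convergent_def)
  then obtain L where L: "\<And>i. (\<lambda>n. ell1_nth (X n) i) \<longlonglongrightarrow> L i"
    by metis
  have tail: "\<exists>M. \<forall>n\<ge>M. \<forall>F. finite F \<longrightarrow> (\<Sum>i\<in>F. \<bar>L i - ell1_nth (X n) i\<bar>) \<le> e" if e: "e > 0" for e
  proof -
    obtain M where M: "\<And>m n. m \<ge> M \<Longrightarrow> n \<ge> M \<Longrightarrow> dist (X m) (X n) < e"
      using X e unfolding Cauchy_def by blast
    have "(\<Sum>i\<in>F. \<bar>L i - ell1_nth (X n) i\<bar>) \<le> e" if "n \<ge> M" "finite F" for n F
    proof (rule LIMSEQ_le_const2)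
      show "(\<lambda>m. \<Sum>i\<in>F. \<bar>ell1_nth (X m) i - ell1_nth (X n) i\<bar>)
          \<longlonglongrightarrow> (\<Sum>i\<in>F. \<bar>L i - ell1_nth (X n) i\<bar>)"
        by (intro tendsto_intros L)
      have "(\<Sum>i\<in>F. \<bar>ell1_nth (X m) i - ell1_nth (X n) i\<bar>) \<le> e" if "m \<ge> M" for m
        using M[OF that \<open>n \<ge> M\<close>] sum_le_norm_ell1[OF \<open>finite F\<close>, of "X m - X n"]
        by (simp add: dist_norm minus_ell1.rep_eq)
      then show "\<exists>N. \<forall>m\<ge>N. (\<Sum>i\<in>F. \<bar>ell1_nth (X m) i - ell1_nth (X n) i\<bar>) \<le> e" by blast
    qed
    then show ?thesis by blast
  qed
  have near: "\<exists>d. ell1_nth d = (\<lambda>i. L i - ell1_nth (X n) i) \<and> norm d \<le> e"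
    if "\<forall>F. finite F \<longrightarrow> (\<Sum>i\<in>F. \<bar>L i - ell1_nth (X n) i\<bar>) \<le> e" for n e
    using that ell1_of_bounded_sums[of "\<lambda>i. L i - ell1_nth (X n) i" e] by metis
  obtain N d where d: "ell1_nth d = (\<lambda>i. L i - ell1_nth (X N) i)"
    using tail[of 1] near by (metis order_refl zero_less_one)
  define l where "l = X N + d"
  have l: "ell1_nth l = L"
    by (rule ext) (simp add: l_def plus_ell1.rep_eq d)
  have "X \<longlonglongrightarrow> l"
  proof (rule metric_LIMSEQ_I)
    fix e :: real assume "e > 0"
    then obtain M where M: "\<forall>n\<ge>M. \<forall>F. finite F \<longrightarrow> (\<Sum>i\<in>F. \<bar>L i - ell1_nth (X n) i\<bar>) \<le> e / 2"
      using tail[of "e / 2"] by auto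
    have "dist (X n) l < e" if n: "n \<ge> M" for n
    proof -
      obtain c where c: "ell1_nth c = (\<lambda>i. L i - ell1_nth (X n) i)" "norm c \<le> e / 2"
        using near M n by blast
      have "c = l - X n" by (rule ell1_eqI) (simp add: c minus_ell1.rep_eq l)
      then show ?thesis using c(2) \<open>e > 0\<close> by (simp add: dist_norm norm_minus_commute)
    qed
    then show "\<exists>M. \<forall>n\<ge>M. dist (X n) l < e" by blast
  qed
  then show "convergent X" by (auto simp: convergent_def)
qed


section \<open>The space of families vanishing at infinity\<close>

text \<open>For a finite index type every family vanishes at infinity, and \<open>'i c0\<close> is the space of all
  families with the maximum norm, that is, \<open>\<ell>\<^sub>\<infinity>\<^sup>N\<close>.\<close>

typedef 'i c0 = "{f :: 'i \<Rightarrow> real. \<forall>e>0. finite {i. e \<le> \<bar>f i\<bar>}}"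
  morphisms c0_nth Abs_c0
  by (rule exI[of _ "\<lambda>_. 0"]) simp

setup_lifting type_definition_c0

lemma c0_eqI: "(\<And>i. c0_nth x i = c0_nth y i) \<Longrightarrow> x = y"
  by (metis c0_nth_inject ext)

lemma c0_finite: "e > 0 \<Longrightarrow> finite {i. e \<le> \<bar>c0_nth x i\<bar>}"
  using c0_nth[of x] by simp

lemma c0_bdd: "bdd_above (range (\<lambda>i. \<bar>c0_nth x i\<bar>))"
proof -
  let ?F = "{i. 1 \<le> \<bar>c0_nth x i\<bar>}"
  have "\<bar>c0_nth x i\<bar> \<le> 1 + (\<Sum>j\<in>?F. \<bar>c0_nth x j\<bar>)" for i
  proof (cases "i \<in> ?F")
    case True
    then show ?thesis
      using member_le_sum[of i ?F "\<lambda>j. \<bar>c0_nth x j\<bar>"] c0_finite[of 1 x] by simp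
  next
    case False
    then show ?thesis by (auto intro!: add_increasing2 sum_nonneg)
  qed
  then show ?thesis by (auto simp: bdd_above_def)
qed

lemma vanishing_add:
  fixes f g :: "'i \<Rightarrow> real"
  assumes "\<And>e. 0 < e \<Longrightarrow> finite {i. e \<le> \<bar>f i\<bar>}" "\<And>e. 0 < e \<Longrightarrow> finite {i. e \<le> \<bar>g i\<bar>}"
    and "0 < e"
  shows "finite {i. e \<le> \<bar>f i + g i\<bar>}"
proof -
  have "finite ({i. e / 2 \<le> \<bar>f i\<bar>} \<union> {i. e / 2 \<le> \<bar>g i\<bar>})"
    by (intro finite_UnI assms(1,2) half_gt_zero \<open>0 < e\<close>)
  then show "finite {i. e \<le> \<bar>f i + g i\<bar>}" by (rule rev_finite_subset) auto
qed

lemma vanishing_cmult: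
  fixes f :: "'i \<Rightarrow> real"
  assumes "\<And>e. 0 < e \<Longrightarrow> finite {i. e \<le> \<bar>f i\<bar>}" and "0 < e"
  shows "finite {i. e \<le> \<bar>c * f i\<bar>}"
proof (cases "c = 0")
  case False
  then have "{i. e \<le> \<bar>c * f i\<bar>} = {i. e / \<bar>c\<bar> \<le> \<bar>f i\<bar>}"
    by (auto simp: abs_mult field_simps)
  then show ?thesis using assms(1)[of "e / \<bar>c\<bar>"] \<open>0 < e\<close> False by simp
qed (use \<open>0 < e\<close> in simp)

instantiation c0 :: (type) real_normed_vector
begin

lift_definition zero_c0 :: "'a c0" is "\<lambda>_. 0" by simp

lift_definition plus_c0 :: "'a c0 \<Rightarrow> 'a c0 \<Rightarrow> 'a c0" is "\<lambda>f g i. f i + g i"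
  by (rule vanishing_add)

lift_definition uminus_c0 :: "'a c0 \<Rightarrow> 'a c0" is "\<lambda>f i. - f i" by simp

lift_definition minus_c0 :: "'a c0 \<Rightarrow> 'a c0 \<Rightarrow> 'a c0" is "\<lambda>f g i. f i - g i"
  using vanishing_add[where g = "\<lambda>i. - g i" for g] by simp blast

lift_definition scaleR_c0 :: "real \<Rightarrow> 'a c0 \<Rightarrow> 'a c0" is "\<lambda>c f i. c * f i"
  by (rule vanishing_cmult)

lift_definition norm_c0 :: "'a c0 \<Rightarrow> real" is "\<lambda>f. SUP i. \<bar>f i\<bar>" .

definition dist_c0 :: "'a c0 \<Rightarrow> 'a c0 \<Rightarrow> real"
  where "dist_c0 x y = norm (x - y)"

definition sgn_c0 :: "'a c0 \<Rightarrow> 'a c0"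
  where "sgn_c0 x = scaleR (inverse (norm x)) x"

definition uniformity_c0 :: "('a c0 \<times> 'a c0) filter"
  where "uniformity_c0 = (INF e\<in>{0 <..}. principal {(x, y). dist x y < e})"

definition open_c0 :: "'a c0 set \<Rightarrow> bool"
  where "open_c0 S = (\<forall>x\<in>S. \<forall>\<^sub>F (x', y) in uniformity. x' = x \<longrightarrow> y \<in> S)"

lemma abs_nth_le_norm_c0: "\<bar>c0_nth x i\<bar> \<le> norm x"
  unfolding norm_c0.rep_eq by (rule cSUP_upper[OF UNIV_I c0_bdd])

lemma norm_c0_le: "(\<And>i. \<bar>c0_nth x i\<bar> \<le> c) \<Longrightarrow> norm x \<le> c"
  unfolding norm_c0.rep_eq by (rule cSUP_least) auto

instance
proof
  fix x y z :: "'a c0" and a b :: real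
  show "x + y + z = x + (y + z)" "x + y = y + x" "0 + x = x" "- x + x = 0" "x - y = x + - y"
    by (transfer; auto)+
  show "a *\<^sub>R (x + y) = a *\<^sub>R x + a *\<^sub>R y" "(a + b) *\<^sub>R x = a *\<^sub>R x + b *\<^sub>R x"
    "a *\<^sub>R b *\<^sub>R x = (a * b) *\<^sub>R x" "1 *\<^sub>R x = x"
    by (transfer; auto simp: algebra_simps)+
  show "dist x y = norm (x - y)" by (rule dist_c0_def)
  show "sgn x = inverse (norm x) *\<^sub>R x" by (rule sgn_c0_def)
  show "uniformity = (INF e\<in>{0 <..}. principal {(x :: 'a c0, y). dist x y < e})"
    by (rule uniformity_c0_def)
  show "open S = (\<forall>x\<in>S. \<forall>\<^sub>F (x', y) in uniformity. x' = x \<longrightarrow> y \<in> S)" for S :: "'a c0 set"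
    by (rule open_c0_def)
  show "norm x = 0 \<longleftrightarrow> x = 0"
  proof
    assume "norm x = 0"
    then show "x = 0"
      using abs_nth_le_norm_c0[of x] by (intro c0_eqI) (simp add: zero_c0.rep_eq)
  qed (simp add: norm_c0.rep_eq zero_c0.rep_eq)
  show "norm (x + y) \<le> norm x + norm y"
  proof (rule norm_c0_le)
    fix i
    show "\<bar>c0_nth (x + y) i\<bar> \<le> norm x + norm y"
      using abs_nth_le_norm_c0[of x i] abs_nth_le_norm_c0[of y i] by (simp add: plus_c0.rep_eq)
  qed
  have le: "norm (c *\<^sub>R w) \<le> \<bar>c\<bar> * norm w" for c and w :: "'a c0"
    by (rule norm_c0_le) (simp add: scaleR_c0.rep_eq abs_mult mult_left_mono abs_nth_le_norm_c0)
  show "norm (a *\<^sub>R x) = \<bar>a\<bar> * norm x"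
  proof (cases "a = 0")
    case True
    then show ?thesis by (simp add: norm_c0.rep_eq scaleR_c0.rep_eq)
  next
    case False
    have "inverse a *\<^sub>R (a *\<^sub>R x) = x"
      using False by (intro c0_eqI) (simp add: scaleR_c0.rep_eq)
    then have "norm x \<le> \<bar>inverse a\<bar> * norm (a *\<^sub>R x)"
      using le[of "inverse a" "a *\<^sub>R x"] by simp
    then have "\<bar>a\<bar> * norm x \<le> norm (a *\<^sub>R x)"
      using False by (simp add: abs_inverse field_simps)
    then show ?thesis using le[of a x] by simp
  qed
qed

end

instance c0 :: (type) banach
proof
  fix X :: "nat \<Rightarrow> 'a c0"
  assume X: "Cauchy X"
  have Cn: "\<exists>M. \<forall>m\<ge>M. \<forall>n\<ge>M. \<forall>i. \<bar>c0_nth (X m) i - c0_nth (X n) i\<bar> < e" if e: "e > 0" for e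
  proof -
    obtain M where M: "\<And>m n. m \<ge> M \<Longrightarrow> n \<ge> M \<Longrightarrow> dist (X m) (X n) < e"
      using X e unfolding Cauchy_def by blast
    have "\<bar>c0_nth (X m) i - c0_nth (X n) i\<bar> < e" if "m \<ge> M" "n \<ge> M" for m n i
      using M[OF that] abs_nth_le_norm_c0[of "X m - X n" i]
      by (simp add: dist_norm minus_c0.rep_eq)
    then show ?thesis by blast
  qed
  have "Cauchy (\<lambda>n. c0_nth (X n) i)" for i
    unfolding Cauchy_def dist_real_def using Cn by metis
  then have "\<exists>l. (\<lambda>n. c0_nth (X n) i) \<longlonglongrightarrow> l" for i
    by (simp add: Cauchy_convergent_iff convergent_def)
  then obtain L where L: "\<And>i. (\<lambda>n. c0_nth (X n) i) \<longlonglongrightarrow> L i"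
    by metis
  have tail: "\<exists>M. \<forall>n\<ge>M. \<forall>i. \<bar>c0_nth (X n) i - L i\<bar> \<le> e" if e: "e > 0" for e
  proof -
    obtain M where M: "\<And>m n i. m \<ge> M \<Longrightarrow> n \<ge> M \<Longrightarrow> \<bar>c0_nth (X m) i - c0_nth (X n) i\<bar> < e"
      using Cn[OF e] by blast
    have "\<bar>c0_nth (X n) i - L i\<bar> \<le> e" if "n \<ge> M" for n i
    proof (rule LIMSEQ_le_const2)
      show "(\<lambda>m. \<bar>c0_nth (X n) i - c0_nth (X m) i\<bar>) \<longlonglongrightarrow> \<bar>c0_nth (X n) i - L i\<bar>"
        by (intro tendsto_intros L)
      show "\<exists>N. \<forall>m\<ge>N. \<bar>c0_nth (X n) i - c0_nth (X m) i\<bar> \<le> e"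
        using M[OF that] by (meson less_imp_le)
    qed
    then show ?thesis by blast
  qed
  have "\<forall>e>0. finite {i. e \<le> \<bar>L i\<bar>}"
  proof (intro allI impI)
    fix e :: real assume e: "e > 0"
    then obtain n where n: "\<And>i. \<bar>c0_nth (X n) i - L i\<bar> \<le> e / 2"
      using tail[of "e / 2"] by auto
    have "{i. e \<le> \<bar>L i\<bar>} \<subseteq> {i. e / 2 \<le> \<bar>c0_nth (X n) i\<bar>}"
    proof safe
      fix i assume "e \<le> \<bar>L i\<bar>"
      then show "e / 2 \<le> \<bar>c0_nth (X n) i\<bar>" using n[of i] by linarith
    qed
    then show "finite {i. e \<le> \<bar>L i\<bar>}"
      using c0_finite[of "e / 2" "X n"] e by (auto intro: finite_subset)
  qed
  then have l: "c0_nth (Abs_c0 L) = L" by (simp add: Abs_c0_inverse)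
  have "X \<longlonglongrightarrow> Abs_c0 L"
  proof (rule metric_LIMSEQ_I)
    fix e :: real assume e: "e > 0"
    then obtain M where M: "\<And>n i. n \<ge> M \<Longrightarrow> \<bar>c0_nth (X n) i - L i\<bar> \<le> e / 2"
      using tail[of "e / 2"] by auto
    have "norm (X n - Abs_c0 L) \<le> e / 2" if "n \<ge> M" for n
      by (rule norm_c0_le) (use M[OF that] in \<open>simp add: minus_c0.rep_eq l\<close>)
    then show "\<exists>M. \<forall>n\<ge>M. dist (X n) (Abs_c0 L) < e"
      using e by (force simp: dist_norm)
  qed
  then show "convergent X" by (auto simp: convergent_def)
qed


section \<open>The canonical identification of \<open>\<ell>\<^sub>1\<close> with the dual of \<open>c\<^sub>0\<close>\<close>

lemma ell1_c0_bound: "\<bar>ell1_nth x i * c0_nth y i\<bar> \<le> \<bar>ell1_nth x i\<bar> * norm y"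
  by (simp add: abs_mult mult_left_mono abs_nth_le_norm_c0)

lemma ell1_c0_abs_summable: "(\<lambda>i. ell1_nth x i * c0_nth y i) abs_summable_on UNIV"
  by (rule abs_summable_on_comparison_test[where g = "\<lambda>i. \<bar>ell1_nth x i\<bar> * norm y"])
    (use ell1_c0_bound[of x _ y] ell1_summable[of x] in \<open>auto intro: summable_on_cmult_left simp: abs_mult\<close>)

lemma ell1_c0_summable: "(\<lambda>i. ell1_nth x i * c0_nth y i) summable_on UNIV"
  using ell1_c0_abs_summable by (rule abs_summable_summable)

lemma ell1_c0_infsum_le: "\<bar>\<Sum>\<^sub>\<infinity>i. ell1_nth x i * c0_nth y i\<bar> \<le> norm x * norm y"
proof -
  have "\<bar>\<Sum>\<^sub>\<infinity>i. ell1_nth x i * c0_nth y i\<bar> \<le> (\<Sum>\<^sub>\<infinity>i. \<bar>ell1_nth x i * c0_nth y i\<bar>)"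
    using norm_infsum_bound[of "\<lambda>i. ell1_nth x i * c0_nth y i" UNIV] ell1_c0_abs_summable[of x y] by simp
  also have "\<dots> \<le> (\<Sum>\<^sub>\<infinity>i. \<bar>ell1_nth x i\<bar> * norm y)"
    using ell1_c0_abs_summable[of x y]
    by (intro infsum_mono) (auto intro: ell1_c0_bound summable_on_cmult_left ell1_summable)
  also have "\<dots> = norm x * norm y"
    by (simp add: infsum_cmult_left' norm_ell1.rep_eq)
  finally show ?thesis .
qed

lift_definition ell1_dual :: "'i ell1 \<Rightarrow> ('i c0 \<Rightarrow>\<^sub>L real)"
  is "\<lambda>x y. \<Sum>\<^sub>\<infinity>i. ell1_nth x i * c0_nth y i"
proof
  fix x :: "'i ell1" and y z :: "'i c0" and r :: real
  show "(\<Sum>\<^sub>\<infinity>i. ell1_nth x i * c0_nth (y + z) i) =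
      (\<Sum>\<^sub>\<infinity>i. ell1_nth x i * c0_nth y i) + (\<Sum>\<^sub>\<infinity>i. ell1_nth x i * c0_nth z i)"
    by (simp add: plus_c0.rep_eq distrib_left infsum_add ell1_c0_summable)
  show "(\<Sum>\<^sub>\<infinity>i. ell1_nth x i * c0_nth (r *\<^sub>R y) i) = r *\<^sub>R (\<Sum>\<^sub>\<infinity>i. ell1_nth x i * c0_nth y i)"
    by (simp add: scaleR_c0.rep_eq mult.left_commute infsum_cmult_right')
  show "\<exists>K. \<forall>y. norm (\<Sum>\<^sub>\<infinity>i. ell1_nth x i * c0_nth y i) \<le> norm y * K"
    by (rule exI[of _ "norm x"]) (use ell1_c0_infsum_le[of x] in \<open>simp add: mult.commute\<close>)
qed

lift_definition c0_restrict :: "'i set \<Rightarrow> ('i \<Rightarrow> real) \<Rightarrow> 'i c0"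
  is "\<lambda>F f i. if finite F \<and> i \<in> F then f i else 0"
proof -
  fix F :: "'i set" and f :: "'i \<Rightarrow> real" and e :: real
  assume "e > 0"
  then have "{i. e \<le> \<bar>if finite F \<and> i \<in> F then f i else 0\<bar>} \<subseteq> (if finite F then F else {})"
    by (auto split: if_splits)
  then show "finite {i. e \<le> \<bar>if finite F \<and> i \<in> F then f i else 0\<bar>}"
    by (rule finite_subset) simp
qed

lemma ell1_dual_c0_restrict:
  assumes "finite F"
  shows "blinfun_apply (ell1_dual x) (c0_restrict F f) = (\<Sum>i\<in>F. ell1_nth x i * f i)"
proof -
  have "(\<Sum>\<^sub>\<infinity>i. ell1_nth x i * c0_nth (c0_restrict F f) i) = (\<Sum>\<^sub>\<infinity>i\<in>F. ell1_nth x i * f i)"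
    by (rule infsum_cong_neutral) (auto simp: c0_restrict.rep_eq assms)
  then show ?thesis using assms by (simp add: ell1_dual.rep_eq)
qed

lemma blinfun_c0_restrict:
  assumes "finite F"
  shows "blinfun_apply \<phi> (c0_restrict F f) = (\<Sum>i\<in>F. blinfun_apply \<phi> (c0_restrict {i} (\<lambda>_. 1)) * f i)"
  using assms
proof (induction F rule: finite_induct)
  case empty
  have "c0_restrict {} f = 0" by (rule c0_eqI) (simp add: c0_restrict.rep_eq zero_c0.rep_eq)
  then show ?case by (simp add: blinfun.zero_right)
next
  case (insert a F)
  have "c0_restrict (insert a F) f = f a *\<^sub>R c0_restrict {a} (\<lambda>_. 1) + c0_restrict F f"
    using insert.hyps
    by (intro c0_eqI) (auto simp: c0_restrict.rep_eq plus_c0.rep_eq scaleR_c0.rep_eq)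
  then show ?case using insert by (simp add: blinfun.add_right blinfun.scaleR_right)
qed

lemma norm_c0_restrict_sgn: "norm (c0_restrict F (\<lambda>i. sgn (g i :: real))) \<le> 1"
  by (rule norm_c0_le) (simp add: c0_restrict.rep_eq abs_sgn_eq)

lemma linear_ell1_dual: "linear ell1_dual"
proof
  fix x y :: "'i ell1" and r :: real
  show "ell1_dual (x + y) = ell1_dual x + ell1_dual y"
    by (rule blinfun_eqI)
      (simp add: ell1_dual.rep_eq blinfun.add_left plus_ell1.rep_eq distrib_right infsum_add ell1_c0_summable)
  show "ell1_dual (r *\<^sub>R x) = r *\<^sub>R ell1_dual x"
    by (rule blinfun_eqI)
      (simp add: ell1_dual.rep_eq blinfun.scaleR_left scaleR_ell1.rep_eq mult.assoc infsum_cmult_right')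
qed

lemma norm_ell1_dual: "norm (ell1_dual x) = norm x"
proof (rule antisym)
  show "norm (ell1_dual x) \<le> norm x"
    by (rule norm_blinfun_bound) (simp_all add: ell1_dual.rep_eq ell1_c0_infsum_le)
  have "(\<Sum>i\<in>F. \<bar>ell1_nth x i\<bar>) \<le> norm (ell1_dual x)" if "finite F" for F
  proof -
    let ?y = "c0_restrict F (\<lambda>i. sgn (ell1_nth x i))"
    have "(\<Sum>i\<in>F. \<bar>ell1_nth x i\<bar>) = blinfun_apply (ell1_dual x) ?y"
      by (simp add: ell1_dual_c0_restrict that abs_sgn mult.commute)
    also have "\<dots> \<le> norm (ell1_dual x) * norm ?y"
      using norm_blinfun[of "ell1_dual x" ?y] by simp
    also have "\<dots> \<le> norm (ell1_dual x)"
      by (intro mult_left_le norm_c0_restrict_sgn norm_ge_zero)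
    finally show ?thesis .
  qed
  then show "norm x \<le> norm (ell1_dual x)"
    unfolding norm_ell1.rep_eq by (intro infsum_le_finite_sums ell1_summable)
qed

lemma bij_ell1_dual: "bij (ell1_dual :: 'i ell1 \<Rightarrow> ('i c0 \<Rightarrow>\<^sub>L real))"
proof (rule bijI)
  show "inj (ell1_dual :: 'i ell1 \<Rightarrow> _)"
    by (metis (no_types, lifting) linear_ell1_dual linear_injective_0 norm_ell1_dual norm_eq_zero)
  show "surj (ell1_dual :: 'i ell1 \<Rightarrow> _)"
  proof (rule surjI)
    fix \<phi> :: "'i c0 \<Rightarrow>\<^sub>L real"
    let ?f = "\<lambda>i. blinfun_apply \<phi> (c0_restrict {i} (\<lambda>_. 1))"
    have "(\<Sum>i\<in>F. \<bar>?f i\<bar>) \<le> norm \<phi>" if "finite F" for F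
    proof -
      let ?y = "c0_restrict F (\<lambda>i. sgn (?f i))"
      have "(\<Sum>i\<in>F. \<bar>?f i\<bar>) = blinfun_apply \<phi> ?y"
        by (subst blinfun_c0_restrict) (simp_all add: that abs_sgn mult.commute)
      also have "\<dots> \<le> norm \<phi> * norm ?y"
        using norm_blinfun[of \<phi> ?y] by simp
      also have "\<dots> \<le> norm \<phi>"
        by (intro mult_left_le norm_c0_restrict_sgn norm_ge_zero)
      finally show ?thesis .
    qed
    then obtain x where x: "ell1_nth x = ?f" using ell1_of_bounded_sums by metis
    have "ell1_dual x = \<phi>"
    proof (rule blinfun_eqI)
      fix y
      have "norm (blinfun_apply (ell1_dual x - \<phi>) y) \<le> norm (ell1_dual x - \<phi>) * e" if e: "e > 0" for e
      proof -
        let ?F = "{i. e \<le> \<bar>c0_nth y i\<bar>}"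
        let ?z = "c0_restrict ?F (c0_nth y)"
        have F: "finite ?F" by (rule c0_finite[OF e])
        have "blinfun_apply (ell1_dual x) ?z = blinfun_apply \<phi> ?z"
          by (simp add: ell1_dual_c0_restrict F x blinfun_c0_restrict[OF F, of \<phi>])
        then have "blinfun_apply (ell1_dual x - \<phi>) y = blinfun_apply (ell1_dual x - \<phi>) (y - ?z)"
          by (simp add: blinfun.diff_left blinfun.diff_right)
        also have "norm \<dots> \<le> norm (ell1_dual x - \<phi>) * norm (y - ?z)"
          by (rule norm_blinfun)
        also have "norm (y - ?z) \<le> e"
          using F e by (intro norm_c0_le) (auto simp: minus_c0.rep_eq c0_restrict.rep_eq)
        finally show ?thesis by (simp add: mult_left_mono)
      qed
      note le = this
      have "norm (blinfun_apply (ell1_dual x - \<phi>) y) \<le> 0"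
      proof (rule field_le_epsilon)
        fix e :: real assume e: "e > 0"
        have pos: "norm (ell1_dual x - \<phi>) + 1 > 0" by (simp add: add_nonneg_pos)
        have "norm (ell1_dual x - \<phi>) * (e / (norm (ell1_dual x - \<phi>) + 1)) \<le> e"
          using e pos by (simp add: field_simps)
        then show "norm (blinfun_apply (ell1_dual x - \<phi>) y) \<le> 0 + e"
          using le[of "e / (norm (ell1_dual x - \<phi>) + 1)"] e pos by simp
      qed
      then show "blinfun_apply (ell1_dual x) y = blinfun_apply \<phi> y"
        by (simp add: blinfun.diff_left)
    qed
    then show "ell1_dual (inv ell1_dual \<phi>) = \<phi>" by (metis f_inv_into_f rangeI)
  qed
qed

end

theory Submission
  imports Defs
begin

text \<open>A norm-one functional \<open>\<phi>\<close> on \<open>\<ell>\<^sub>1\<close>, weak-star continuous or not, is almost normed by some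
  signed unit vector \<open>\<sigma> e\<^sub>n\<close>, and \<open>\<parallel>\<sigma> e\<^sub>n - x\<parallel> \<ge> 1 + \<parallel>x\<parallel> - 2 \<bar>x\<^sub>n\<bar>\<close>; this gives the lower bound for
  all slices. For the upper bound choose \<open>n\<close> with \<open>\<bar>x\<^sub>n\<bar>\<close> close to the supremum. The coordinate
  functional \<open>y \<mapsto> sgn(x\<^sub>n) y\<^sub>n\<close> is weak-star continuous and defines a slice that contains \<open>x\<close> and
  in which \<open>y\<^sub>n\<close> almost dominates \<open>x\<^sub>n\<close>, so that \<open>\<bar>x\<^sub>n\<bar>\<close> is lost from both \<open>\<parallel>x\<parallel>\<close> and \<open>\<parallel>y\<parallel>\<close> in
  \<open>\<parallel>y - x\<parallel>\<close>. Thus a single slice family bounds all four constants.\<close>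

section \<open>Unit vectors and norms split at one coordinate\<close>

lift_definition ell1_unit :: "'i \<Rightarrow> 'i ell1" is "\<lambda>n i. if i = n then 1 else 0"
proof -
  fix n :: 'i
  have "(\<lambda>i. \<bar>if i = n then 1 else 0 :: real\<bar>) summable_on UNIV \<longleftrightarrow>
      (\<lambda>i. \<bar>if i = n then 1 else 0 :: real\<bar>) summable_on {n}"
    by (rule summable_on_cong_neutral) auto
  then show "(\<lambda>i. if i = n then 1 else 0 :: real) abs_summable_on UNIV" by simp
qed

lemma norm_ell1_split:
  "norm x = \<bar>ell1_nth x n\<bar> + (\<Sum>\<^sub>\<infinity>i\<in>-{n}. \<bar>ell1_nth x i\<bar>)"
proof -
  have "(\<Sum>\<^sub>\<infinity>i\<in>{n} \<union> -{n}. \<bar>ell1_nth x i\<bar>) =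
      (\<Sum>\<^sub>\<infinity>i\<in>{n}. \<bar>ell1_nth x i\<bar>) + (\<Sum>\<^sub>\<infinity>i\<in>-{n}. \<bar>ell1_nth x i\<bar>)"
    by (rule infsum_Un_disjoint) (auto intro: summable_on_subset_banach[OF ell1_summable])
  moreover have "{n} \<union> -{n} = UNIV" by auto
  ultimately show ?thesis by (simp add: norm_ell1.rep_eq)
qed

lemma norm_scaleR_ell1_unit [simp]: "norm (c *\<^sub>R ell1_unit n) = \<bar>c\<bar>"
proof -
  have "(\<Sum>\<^sub>\<infinity>i\<in>-{n}. \<bar>ell1_nth (c *\<^sub>R ell1_unit n) i\<bar>) = 0"
    by (rule infsum_0) (auto simp: scaleR_ell1.rep_eq ell1_unit.rep_eq)
  then show ?thesis
    by (subst norm_ell1_split[of _ n]) (simp add: scaleR_ell1.rep_eq ell1_unit.rep_eq)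
qed

lemma norm_ell1_unit [simp]: "norm (ell1_unit n) = 1"
  using norm_scaleR_ell1_unit[of 1 n] by simp

text \<open>Off \<open>n\<close> the difference agrees with \<open>x\<close> up to sign; at
  \<open>n\<close> it is at least \<open>1 - \<bar>ell1_nth x n\<bar>\<close>.\<close>

lemma norm_ell1_unit_diff_ge:
  assumes "\<bar>c\<bar> = 1"
  shows "norm (c *\<^sub>R ell1_unit n - x) \<ge> 1 + norm x - 2 * \<bar>ell1_nth x n\<bar>"
proof -
  have "(\<Sum>\<^sub>\<infinity>i\<in>-{n}. \<bar>ell1_nth (c *\<^sub>R ell1_unit n - x) i\<bar>) = (\<Sum>\<^sub>\<infinity>i\<in>-{n}. \<bar>ell1_nth x i\<bar>)"
    by (rule infsum_cong) (auto simp: minus_ell1.rep_eq scaleR_ell1.rep_eq ell1_unit.rep_eq)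
  then have "norm (c *\<^sub>R ell1_unit n - x) = \<bar>c - ell1_nth x n\<bar> + norm x - \<bar>ell1_nth x n\<bar>"
    using norm_ell1_split[of "c *\<^sub>R ell1_unit n - x" n] norm_ell1_split[of x n]
    by (simp add: minus_ell1.rep_eq scaleR_ell1.rep_eq ell1_unit.rep_eq)
  then show ?thesis using assms by linarith
qed

text \<open>The triangle inequality is used only off \<open>n\<close>; the bracket keeps the exact
  cancellation at \<open>n\<close>.\<close>

lemma norm_ell1_diff_le:
  "norm (y - x) \<le> norm y + norm x +
    (\<bar>ell1_nth y n - ell1_nth x n\<bar> - \<bar>ell1_nth y n\<bar> - \<bar>ell1_nth x n\<bar>)"
proof -
  have summable: "(\<lambda>i. \<bar>ell1_nth z i\<bar>) summable_on -{n}" for z :: "'a ell1"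
    by (rule summable_on_subset_banach[OF ell1_summable]) simp
  have "(\<Sum>\<^sub>\<infinity>i\<in>-{n}. \<bar>ell1_nth (y - x) i\<bar>) \<le> (\<Sum>\<^sub>\<infinity>i\<in>-{n}. \<bar>ell1_nth y i\<bar> + \<bar>ell1_nth x i\<bar>)"
    by (intro infsum_mono summable summable_on_add) (simp add: minus_ell1.rep_eq)
  also have "\<dots> = (\<Sum>\<^sub>\<infinity>i\<in>-{n}. \<bar>ell1_nth y i\<bar>) + (\<Sum>\<^sub>\<infinity>i\<in>-{n}. \<bar>ell1_nth x i\<bar>)"
    by (intro infsum_add summable)
  finally show ?thesis
    using norm_ell1_split[of y n] norm_ell1_split[of x n] norm_ell1_split[of "y - x" n]
    by (simp add: minus_ell1.rep_eq)
qed

section \<open>Expansion in unit vectors and norming of functionals\<close>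

lemma has_sum_ell1_unit: "((\<lambda>i. ell1_nth x i *\<^sub>R ell1_unit i) has_sum x) UNIV"
proof -
  have "(\<lambda>i. ell1_nth x i *\<^sub>R ell1_unit i) abs_summable_on UNIV"
    using ell1_summable[of x] by simp
  then have "(\<lambda>i. ell1_nth x i *\<^sub>R ell1_unit i) summable_on UNIV"
    by (rule abs_summable_summable)
  then obtain z where z: "((\<lambda>i. ell1_nth x i *\<^sub>R ell1_unit i) has_sum z) UNIV"
    by (auto simp: summable_on_def)
  \<comment> \<open>Completeness only yields some sum \<open>z\<close>; continuity of the
    coordinates identifies it.\<close>
  have "ell1_nth z j = ell1_nth x j" for j
  proof -
    have "bounded_linear (\<lambda>z. ell1_nth z j)"
      by (rule bounded_linear_intro[where K = 1])
        (auto simp: plus_ell1.rep_eq scaleR_ell1.rep_eq abs_nth_le_norm_ell1)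
    from has_sum_bounded_linear[OF this z]
    have "((\<lambda>i. ell1_nth x i * ell1_nth (ell1_unit i) j) has_sum ell1_nth z j) UNIV"
      by (simp add: o_def scaleR_ell1.rep_eq)
    moreover have "((\<lambda>i. ell1_nth x i * ell1_nth (ell1_unit i) j) has_sum ell1_nth x j) UNIV"
      by (rule has_sum_finite_neutralI[of "{j}"]) (auto simp: ell1_unit.rep_eq)
    ultimately show ?thesis by (rule has_sum_unique)
  qed
  then have "z = x" by (rule ell1_eqI)
  with z show ?thesis by simp
qed

text \<open>The norm-convergent expansion shows that any bounded functional is determined by its
  values on unit vectors, as in the duality of ell_1 and ell_infinity.\<close>

lemma norm_blinfun_ell1_le:
  fixes f :: "'i ell1 \<Rightarrow>\<^sub>L real"
  assumes "0 \<le> c" "\<And>i. \<bar>f (ell1_unit i)\<bar> \<le> c"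
  shows "norm f \<le> c"
proof (rule norm_blinfun_bound[OF assms(1)])
  fix x
  have "((\<lambda>i. ell1_nth x i * f (ell1_unit i)) has_sum f x) UNIV"
    using has_sum_bounded_linear[OF blinfun.bounded_linear_right has_sum_ell1_unit, of f x]
    by (simp add: o_def blinfun.scaleR_right)
  moreover have "((\<lambda>i. c * \<bar>ell1_nth x i\<bar>) has_sum c * norm x) UNIV"
    unfolding norm_ell1.rep_eq by (intro has_sum_cmult_right has_sum_infsum ell1_summable)
  ultimately show "norm (f x) \<le> c * norm x"
  proof (rule norm_infsum_le)
    show "norm (ell1_nth x i * f (ell1_unit i)) \<le> c * \<bar>ell1_nth x i\<bar>" for i
      using mult_right_mono[OF assms(2)[of i] abs_ge_zero[of "ell1_nth x i"]]
      by (simp add: abs_mult mult.commute)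
  qed
qed

lemma ex_ell1_unit_in_slice:
  fixes f :: "'i ell1 \<Rightarrow>\<^sub>L real"
  assumes "norm f = 1" "\<delta> > 0"
  shows "\<exists>n c. \<bar>c\<bar> = 1 \<and> f (c *\<^sub>R ell1_unit n) > 1 - \<delta>"
proof -
  obtain n where n: "\<bar>f (ell1_unit n)\<bar> > 1 - \<delta>"
  proof (rule ccontr)
    assume "\<not> thesis"
    then have "\<bar>f (ell1_unit i)\<bar> \<le> 1 - \<delta>" for i using that by (meson not_le)
    \<comment> \<open>Index types are nonempty, so a single value already forces the bound to be
      nonnegative.\<close>
    moreover from this have "0 \<le> 1 - \<delta>" by (meson abs_ge_zero order_trans)
    ultimately have "norm f \<le> 1 - \<delta>" by (intro norm_blinfun_ell1_le)
    with assms show False by simp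
  qed
  show ?thesis
  proof (cases "f (ell1_unit n) \<ge> 0")
    case True
    then show ?thesis using n by (intro exI[of _ n] exI[of _ 1]) simp
  next
    case False
    then show ?thesis using n by (intro exI[of _ n] exI[of _ "-1"]) (simp add: blinfun.minus_right)
  qed
qed

section \<open>Coordinate functionals and their representatives in c_0\<close>

lift_definition ell1_coord :: "'i \<Rightarrow> 'i ell1 \<Rightarrow>\<^sub>L real" is "\<lambda>n x. ell1_nth x n"
  by (rule bounded_linear_intro[where K = 1])
    (auto simp: plus_ell1.rep_eq scaleR_ell1.rep_eq abs_nth_le_norm_ell1)

lemma norm_ell1_coord: "norm (ell1_coord n) = 1"
proof (rule antisym)
  show "norm (ell1_coord n) \<le> 1"
    by (rule norm_blinfun_bound) (auto simp: ell1_coord.rep_eq abs_nth_le_norm_ell1)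
  show "1 \<le> norm (ell1_coord n)"
    using norm_blinfun[of "ell1_coord n" "ell1_unit n"]
    by (simp add: ell1_coord.rep_eq ell1_unit.rep_eq)
qed

lemma ell1_dual_c0_single: "ell1_dual x (c0_restrict {n} (\<lambda>_. c)) = c * ell1_nth x n"
  by (simp add: ell1_dual_c0_restrict)

lemma norm_c0_single: "norm (c0_restrict {n} (\<lambda>_. c)) = \<bar>c\<bar>"
proof (rule antisym)
  show "norm (c0_restrict {n} (\<lambda>_. c)) \<le> \<bar>c\<bar>"
    by (rule norm_c0_le) (simp add: c0_restrict.rep_eq)
  show "\<bar>c\<bar> \<le> norm (c0_restrict {n} (\<lambda>_. c))"
    using abs_nth_le_norm_c0[of "c0_restrict {n} (\<lambda>_. c)" n] by (simp add: c0_restrict.rep_eq)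
qed

lemma ell1_dual_unit: "ell1_dual (ell1_unit n) y = c0_nth y n"
proof -
  have "(\<Sum>\<^sub>\<infinity>i. ell1_nth (ell1_unit n) i * c0_nth y i) = (\<Sum>\<^sub>\<infinity>i\<in>{n}. c0_nth y i)"
    by (rule infsum_cong_neutral) (auto simp: ell1_unit.rep_eq)
  then show ?thesis by (simp add: ell1_dual.rep_eq)
qed

text \<open>The norm of \<open>y\<close> is the supremum of its coordinates in absolute value, and
  these are the values of unit vectors at \<open>y\<close>.\<close>

lemma ex_ell1_unit_in_weak_star_slice:
  fixes y :: "'i c0"
  assumes "norm y = 1" "\<delta> > 0"
  shows "\<exists>n c. \<bar>c\<bar> = 1 \<and> ell1_dual (c *\<^sub>R ell1_unit n) y > 1 - \<delta>"
proof -
  have dual: "ell1_dual (c *\<^sub>R ell1_unit n) y = c * c0_nth y n" for c n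
    by (simp add: linear_scale[OF linear_ell1_dual] blinfun.scaleR_left ell1_dual_unit)
  obtain n where n: "\<bar>c0_nth y n\<bar> > 1 - \<delta>"
  proof (rule ccontr)
    assume "\<not> thesis"
    then have "norm y \<le> 1 - \<delta>" using that by (intro norm_c0_le) (meson not_le)
    with assms show False by simp
  qed
  show ?thesis
  proof (cases "c0_nth y n \<ge> 0")
    case True
    then show ?thesis using n by (intro exI[of _ n] exI[of _ 1]) (simp only: dual, simp)
  next
    case False
    then show ?thesis using n by (intro exI[of _ n] exI[of _ "-1"]) (simp only: dual, simp)
  qed
qed

lemma bdd_above_ell1_nth: "bdd_above (range (\<lambda>n. \<bar>ell1_nth x n\<bar>))"
  by (rule bdd_aboveI[of _ "norm x"]) (auto simp: abs_nth_le_norm_ell1)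

text \<open>The four constants differ only in the family \<open>W\<close> of functionals that define the slices, and in
  the slices that are tested: \<open>C\<close> is constantly true for the Daugavet constants and says that \<open>x\<close> lies
  in the slice for the \<open>\<Delta>\<close>-constants.\<close>

lemma Sup_slice_const:
  fixes x :: "'i ell1" and W :: "('i ell1 \<Rightarrow> real) set"
  assumes x: "norm x \<le> 1"
    and unit: "\<And>\<phi> \<delta>. \<phi> \<in> W \<Longrightarrow> \<delta> > 0 \<Longrightarrow> \<exists>n c. \<bar>c\<bar> = 1 \<and> \<phi> (c *\<^sub>R ell1_unit n) > 1 - \<delta>"
    and coord: "\<And>n c. \<bar>c\<bar> = 1 \<Longrightarrow> (\<lambda>y. c * ell1_nth y n) \<in> W"
    and C: "\<And>\<phi> \<delta>. \<phi> x > 1 - \<delta> \<Longrightarrow> C \<phi> \<delta>"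
  shows "Sup {\<alpha>. \<alpha> \<ge> 0 \<and> (\<forall>\<epsilon>>0. \<forall>\<delta>>0. \<forall>\<phi>\<in>W. C \<phi> \<delta> \<longrightarrow>
      (\<exists>y. norm y \<le> 1 \<and> \<phi> y > 1 - \<delta> \<and> norm (y - x) > \<alpha> - \<epsilon>))}
    = 1 + norm x - 2 * (SUP n. \<bar>ell1_nth x n\<bar>)" (is "Sup ?A = ?v")
proof (rule cSup_eq_maximum)
  let ?s = "SUP n. \<bar>ell1_nth x n\<bar>"
  have le_s: "\<bar>ell1_nth x n\<bar> \<le> ?s" for n by (rule cSUP_upper[OF UNIV_I bdd_above_ell1_nth])
  have "?s \<le> norm x" by (rule cSUP_least) (auto simp: abs_nth_le_norm_ell1)
  then have "?v \<ge> 0" using x by linarith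
  moreover have "\<exists>y. norm y \<le> 1 \<and> \<phi> y > 1 - \<delta> \<and> norm (y - x) > ?v - \<epsilon>"
    if "\<epsilon> > 0" "\<delta> > 0" "\<phi> \<in> W" for \<epsilon> \<delta> \<phi>
  proof -
    obtain n c where nc: "\<bar>c\<bar> = 1" "\<phi> (c *\<^sub>R ell1_unit n) > 1 - \<delta>"
      using unit \<open>\<phi> \<in> W\<close> \<open>\<delta> > 0\<close> by blast
    have "norm (c *\<^sub>R ell1_unit n - x) > ?v - \<epsilon>"
      using norm_ell1_unit_diff_ge[OF nc(1), of x n] le_s[of n] \<open>\<epsilon> > 0\<close> by linarith
    with nc show ?thesis by (intro exI[of _ "c *\<^sub>R ell1_unit n"]) simp
  qed
  ultimately show "?v \<in> ?A" by blast
next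
  let ?s = "SUP n. \<bar>ell1_nth x n\<bar>"
  fix \<alpha> assume \<alpha>: "\<alpha> \<in> ?A"
  show "\<alpha> \<le> ?v"
  proof (rule field_le_epsilon)
    fix e :: real assume e: "e > 0"
    \<comment> \<open>Of the five \<open>\<eta>\<close>, two come from the choice of
      \<open>n\<close>, two from the slice and one from the choice of \<open>y\<close>.\<close>
    define \<eta> where "\<eta> = e / 5"
    have \<eta>: "\<eta> > 0" "e = 5 * \<eta>" using e by (simp_all add: \<eta>_def)
    have "\<exists>n. ?s - \<eta> < \<bar>ell1_nth x n\<bar>"
      using less_cSUP_iff[OF _ bdd_above_ell1_nth[of x], of "?s - \<eta>"] \<eta>(1) by auto
    then obtain n where n: "?s - \<eta> < \<bar>ell1_nth x n\<bar>" ..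
    \<comment> \<open>Unlike \<open>sgn\<close>, this sign is 1 at 0, so the functional keeps norm
      one even if the coordinate vanishes.\<close>
    define c :: real where "c = (if ell1_nth x n < 0 then -1 else 1)"
    \<comment> \<open>The slice condition becomes
      \<open>c * ell1_nth y n > \<bar>ell1_nth x n\<bar> - \<eta>\<close>, which \<open>x\<close>
      satisfies.\<close>
    define \<delta> where "\<delta> = 1 - \<bar>ell1_nth x n\<bar> + \<eta>"
    have "\<bar>ell1_nth x n\<bar> \<le> 1" using abs_nth_le_norm_ell1[of x n] x by linarith
    then have "\<delta> > 0" using \<eta>(1) by (simp add: \<delta>_def)
    have c: "\<bar>c\<bar> = 1" "c * ell1_nth x n = \<bar>ell1_nth x n\<bar>" by (auto simp: c_def)
    have "C (\<lambda>y. c * ell1_nth y n) \<delta>"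
      by (rule C) (use \<eta>(1) in \<open>simp add: c(2) \<delta>_def\<close>)
    with \<alpha> coord[OF c(1), of n] \<open>\<delta> > 0\<close> \<eta>(1)
    obtain y where y: "norm y \<le> 1" "c * ell1_nth y n > 1 - \<delta>" "norm (y - x) > \<alpha> - \<eta>"
      by blast
    \<comment> \<open>For agreeing signs the left side is minus twice the smaller modulus. Opposite
      signs force \<open>\<bar>ell1_nth x n\<bar> < \<eta>\<close>, and then the right side is
      positive.\<close>
    have "\<bar>ell1_nth y n - ell1_nth x n\<bar> - \<bar>ell1_nth y n\<bar> - \<bar>ell1_nth x n\<bar>
        \<le> 2 * \<eta> - 2 * \<bar>ell1_nth x n\<bar>"
      using y(2) \<eta>(1) by (auto simp: c_def \<delta>_def split: if_splits)
    with norm_ell1_diff_le[of y x n] y n \<eta> show "\<alpha> \<le> ?v + e" by linarith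
  qed
qed

lemma bex_slice_iff:
  "(\<exists>y\<in>slice f \<delta>. P y) \<longleftrightarrow> (\<exists>y. norm y \<le> 1 \<and> f y > 1 - \<delta> \<and> P y)"
  by (auto simp: slice_def)

text \<open>As \<open>ell1_dual\<close> is an isometric bijection, weak-star slices can be searched
  within ell_1, the form that \<open>Sup_slice_const\<close> treats.\<close>

lemma bex_weak_star_slice_iff:
  "(\<exists>g\<in>weak_star_slice y \<delta>. P g) \<longleftrightarrow>
    (\<exists>z. norm z \<le> 1 \<and> ell1_dual z y > 1 - \<delta> \<and> P (ell1_dual z))"
proof
  assume "\<exists>g\<in>weak_star_slice y \<delta>. P g"
  then obtain g :: "'a c0 \<Rightarrow>\<^sub>L real" where g: "norm g \<le> 1" "g y > 1 - \<delta>" "P g" by (auto simp: weak_star_slice_def)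
  obtain z where "g = ell1_dual z" using bij_ell1_dual by (metis bij_pointE)
  with g show "\<exists>z. norm z \<le> 1 \<and> ell1_dual z y > 1 - \<delta> \<and> P (ell1_dual z)"
    by (auto simp: norm_ell1_dual)
next
  assume "\<exists>z. norm z \<le> 1 \<and> ell1_dual z y > 1 - \<delta> \<and> P (ell1_dual z)"
  then obtain z where "norm z \<le> 1" "ell1_dual z y > 1 - \<delta>" "P (ell1_dual z)" by blast
  then show "\<exists>g\<in>weak_star_slice y \<delta>. P g"
    by (intro bexI[of _ "ell1_dual z"]) (simp_all add: weak_star_slice_def norm_ell1_dual)
qed

lemma Daugavet_Delta_const_ell1:
  fixes x :: "'i ell1"
  assumes x: "norm x \<le> 1"
  shows "Daugavet_const x = 1 + norm x - 2 * (SUP n. \<bar>ell1_nth x n\<bar>)"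
    and "Delta_const x = 1 + norm x - 2 * (SUP n. \<bar>ell1_nth x n\<bar>)"
proof -
  let ?W = "blinfun_apply ` sphere (0 :: 'i ell1 \<Rightarrow>\<^sub>L real) 1"
  have unit: "\<exists>n c. \<bar>c\<bar> = 1 \<and> \<phi> (c *\<^sub>R ell1_unit n) > 1 - \<delta>" if "\<phi> \<in> ?W" "\<delta> > 0" for \<phi> \<delta>
    using that ex_ell1_unit_in_slice by fastforce
  have coord: "(\<lambda>y. c * ell1_nth y n) \<in> ?W" if "\<bar>c\<bar> = 1" for c n
    by (rule image_eqI[of _ _ "c *\<^sub>R ell1_coord n"])
      (use that in \<open>auto simp: norm_ell1_coord blinfun.scaleR_left ell1_coord.rep_eq\<close>)
  show "Daugavet_const x = 1 + norm x - 2 * (SUP n. \<bar>ell1_nth x n\<bar>)"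
    using Sup_slice_const[where C = "\<lambda>_ _. True", OF x unit coord]
    by (simp add: Daugavet_const_def bex_slice_iff)
  show "Delta_const x = 1 + norm x - 2 * (SUP n. \<bar>ell1_nth x n\<bar>)"
    using Sup_slice_const[where C = "\<lambda>\<phi> \<delta>. \<phi> x > 1 - \<delta>", OF x unit coord] x
    by (simp add: Delta_const_def bex_slice_iff) (simp add: slice_def)
qed

lemma weak_star_Daugavet_Delta_const_ell1:
  fixes x :: "'i ell1"
  assumes x: "norm x \<le> 1"
  shows "weak_star_Daugavet_const (ell1_dual x) = 1 + norm x - 2 * (SUP n. \<bar>ell1_nth x n\<bar>)"
    and "weak_star_Delta_const (ell1_dual x) = 1 + norm x - 2 * (SUP n. \<bar>ell1_nth x n\<bar>)"
proof -
  \<comment> \<open>Points of the unit sphere of c_0 act on ell_1 by evaluation.\<close>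
  let ?W = "(\<lambda>y z. ell1_dual z y) ` sphere (0 :: 'i c0) 1"
  have unit: "\<exists>n c. \<bar>c\<bar> = 1 \<and> \<phi> (c *\<^sub>R ell1_unit n) > 1 - \<delta>" if "\<phi> \<in> ?W" "\<delta> > 0" for \<phi> \<delta>
    using that ex_ell1_unit_in_weak_star_slice by fastforce
  have coord: "(\<lambda>y. c * ell1_nth y n) \<in> ?W" if "\<bar>c\<bar> = 1" for c n
    by (rule image_eqI[of _ _ "c0_restrict {n} (\<lambda>_. c)"])
      (use that in \<open>auto simp: norm_c0_single ell1_dual_c0_single\<close>)
  have norm_diff: "norm (ell1_dual y - ell1_dual x) = norm (y - x)" for y
    by (metis linear_diff linear_ell1_dual norm_ell1_dual)
  show "weak_star_Daugavet_const (ell1_dual x) = 1 + norm x - 2 * (SUP n. \<bar>ell1_nth x n\<bar>)"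
    using Sup_slice_const[where C = "\<lambda>_ _. True", OF x unit coord]
    by (simp add: weak_star_Daugavet_const_def bex_weak_star_slice_iff norm_diff)
  show "weak_star_Delta_const (ell1_dual x) = 1 + norm x - 2 * (SUP n. \<bar>ell1_nth x n\<bar>)"
    using Sup_slice_const[where C = "\<lambda>\<phi> \<delta>. \<phi> x > 1 - \<delta>", OF x unit coord] x
    by (simp add: weak_star_Delta_const_def bex_weak_star_slice_iff norm_diff)
      (simp add: weak_star_slice_def norm_ell1_dual)
qed

text \<open>The case of N indices is modelled by a type \<open>'n\<close> of class
  \<open>finite\<close>, whose nonemptiness matches N at least 1. Both cases specialize the result
  for arbitrary index types.\<close>

theorem corollary3p9:
  shows "(\<forall>x :: nat ell1. norm x \<le> 1 \<longrightarrow>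
      Daugavet_const x = 1 + norm x - 2 * (SUP n. \<bar>ell1_nth x n\<bar>) \<and>
      Delta_const x = 1 + norm x - 2 * (SUP n. \<bar>ell1_nth x n\<bar>) \<and>
      weak_star_Daugavet_const (ell1_dual x) = 1 + norm x - 2 * (SUP n. \<bar>ell1_nth x n\<bar>) \<and>
      weak_star_Delta_const (ell1_dual x) = 1 + norm x - 2 * (SUP n. \<bar>ell1_nth x n\<bar>)) \<and>
    (\<forall>x :: 'n::finite ell1. norm x \<le> 1 \<longrightarrow>
      Daugavet_const x = 1 + norm x - 2 * (SUP n. \<bar>ell1_nth x n\<bar>) \<and>
      Delta_const x = 1 + norm x - 2 * (SUP n. \<bar>ell1_nth x n\<bar>) \<and>
      weak_star_Daugavet_const (ell1_dual x) = 1 + norm x - 2 * (SUP n. \<bar>ell1_nth x n\<bar>) \<and>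
      weak_star_Delta_const (ell1_dual x) = 1 + norm x - 2 * (SUP n. \<bar>ell1_nth x n\<bar>))"
  by (simp add: Daugavet_Delta_const_ell1 weak_star_Daugavet_Delta_const_ell1)

end
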